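(* For every Tamari interval $I=[P,Q]$, we have $\mathrm{Conj}_{\mathcal F}(\Phi(I))=\Phi(\mathrm{Conj}_{\mathcal I}(I))$, and the following relations hold: $$|\Phi(I)|_E=\mathrm{Val}(P)+1,\quad |\Phi(I)|_N=\mathrm{DR}(P)+1,\quad |\Phi(I)|_W=\mathrm{Val}(Q)+1,\quad |\Phi(I)|_S=\mathrm{DR}(Q)+1 .$$
   Context: **Fish.** Non-empty fighting fish are the words on $\{E,N,W,S\}$ obtainable from $ENWS$ by finitely many operations of the form: replace a factor (contiguous subword) $W$ by $NWS$; replace a factor $N$ by $ENW$; replace a factor $WN$ by $NW$. Non-empty extended fighting fish are the words on $\{E,N,W,S,V\}$ obtained from a non-empty fighting fish by choosing a (possibly empty) set of occurrences of the factor $WN$ and replacing each chosen one by $V$. The empty fish $\varepsilon$ is the word $EVS$, also considered an extended fighting fish. $|F|_X$ is the number of letters $X$ in $F$. The conjugate $\mathrm{Conj}_{\mathcal F}(F)$ is obtained by reversing the word $F$ and exchanging the letters $E\leftrightarrow S$, $N\leftrightarrow W$ ($V$ unchanged). The jaw length $\mathrm{jaw}(F)$ of a non-empty $F$ is the number of initial consecutive letters $E$ (the next letter is then always $N$); $\mathrm{jaw}(\varepsilon)=0$. Concatenation: for non-empty $F_1=G_1S$ and $F_2=E^{\mathrm{jaw}(F_2)}NG_2$, $F_1\odot F_2=E^{\mathrm{jaw}(F_2)}G_1G_2$; and $F\odot\varepsilon=\varepsilon\odot F=F$. Augmentation: for non-empty $F=E^{j}NG$ with $j=\mathrm{jaw}(F)$,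 $\maltese_i(F)=E^iNE^{j-i}NGS$ if $1\le i\le j$, and $\maltese_{j+1}(F)=E^{j+1}NVGS$; and $\maltese_1(\varepsilon)=ENWS$. A pointed extended fighting fish $F^{\bullet i}$ is a pair $(F,i)$ with $1\le i\le \mathrm{jaw}(F)+1$. Set $\oplus_{\mathcal F}(F_1^{\bullet i},F_2)=\maltese_i(F_1)\odot F_2$. **Dyck paths.** A Dyck path of size $n\ge0$ is a word with $n$ letters $u=(1,1)$ and $n$ letters $d=(1,-1)$, seen as a walk from $(0,0)$ staying weakly above the $x$-axis; $\bullet$ is the empty path. $\mathrm{Val}(P)$ is the number of factors $du$ of $P$ and $\mathrm{DR}(P)$ the number of factors $uu$. A contact is a point of the path on the $x$-axis; $c_0(P)$ is the number of non-initial contacts. The Tamari order $\preceq$ on Dyck paths of size $n$ is the reflexive transitive closure of: $VdP_1W$ is covered by $VP_1dW$, where $V,W$ are words and $P_1$ is a non-empty Dyck path returning to the $x$-axis only at its end. Every non-empty Dyck path is uniquely $P_1uP_2d$ with Dyck paths $P_1,P_2$; conjugation is defined by $\mathrm{Conj}_{\mathcal D}(\bullet)=\bullet$, $\mathrm{Conj}_{\mathcal D}(P_1uP_2d)=\mathrm{Conj}_{\mathcal D}(P_2)\,u\,\mathrm{Conj}_{\mathcal D}(P_1)\,d$; it is an order-reversing involution of the Tamari lattice. **Intervals.** A Tamari interval of size $n\ge0$ is a pair $I=[P,Q]$ of Dyck paths of size $n$ with $P\preceq Q$; $c_0(I)=c_0(P)$; $\mathrm{Conj}_{\mathcal I}(I)=[\mathrm{Conj}_{\mathcal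 D}(Q),\mathrm{Conj}_{\mathcal D}(P)]$. A pointed Tamari interval $I^{\bullet i}$ is an interval $I=[P,Q]$ with an integer $1\le i\le c_0(I)+1$; it singles out the $i$-th contact of $P$ counted from right to left, which splits $P=P^\ell P^r$ into two (possibly empty) Dyck paths. Set $[P_1,Q_1]\odot[P_2,Q_2]=[P_1P_2,Q_1Q_2]$, $\maltese_i([P_1,Q_1])=[uP_1^\ell dP_1^r,uQ_1d]$, and $\oplus_{\mathcal I}(I_1^{\bullet i},I_2)=\maltese_i(I_1)\odot I_2$. It is known that $\oplus_{\mathcal I}$ is a bijection from pairs (pointed Tamari interval, Tamari interval) to Tamari intervals different from $[\bullet,\bullet]$. **The map $\Phi$.** $\Phi$ is the bijection from Tamari intervals to extended fighting fish defined recursively by $\Phi([\bullet,\bullet])=\varepsilon$ and $\Phi(\oplus_{\mathcal I}(I_1^{\bullet i},I_2))=\oplus_{\mathcal F}(\Phi(I_1)^{\bullet i},\Phi(I_2))$; this is well defined because $\mathrm{jaw}(\Phi(I))=c_0(I)$ for every $I$.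
   Formalization: The relations for the letters N and W are stated only for non-empty intervals, because they fail for [•,•]: its fish EVS has no N and no W, while DR(•)+1 = Val(•)+1 = 1. The conjugation identity and the E and S relations are stated for all intervals. *)

theory Defs
  imports Complex_Main
begin

section \<open>Dyck paths\<close>

datatype step = Up | Down

definition height :: "step list \<Rightarrow> int" where
  "height P = int (count_list P Up) - int (count_list P Down)"

definition dyck :: "step list \<Rightarrow> bool" where
  "dyck P \<longleftrightarrow> height P = 0 \<and> (\<forall>k \<le> length P. 0 \<le> height (take k P))"

definition factor_count :: "'a list \<Rightarrow> 'a list \<Rightarrow> nat" where
  "factor_count w P = card {k. k + length w \<le> length P \<and> take (length w) (drop k P) = w}"

definition Val :: "step list \<Rightarrow> nat" where
  "Val P = factor_count [Down, Up] P"

definition DR :: "step list \<Rightarrow> nat" where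
  "DR P = factor_count [Up, Up] P"

text \<open>A contact is represented by the number of steps that precede it.\<close>

definition contacts :: "step list \<Rightarrow> nat set" where
  "contacts P = {k. k \<le> length P \<and> height (take k P) = 0}"

definition c0 :: "step list \<Rightarrow> nat" where
  "c0 P = card (contacts P - {0})"

definition contact_from_right :: "nat \<Rightarrow> step list \<Rightarrow> nat" where
  "contact_from_right i P = rev (sorted_list_of_set (contacts P)) ! (i - 1)"

inductive tamari_cover :: "step list \<Rightarrow> step list \<Rightarrow> bool" where
  "\<lbrakk>dyck (V @ [Down] @ P1 @ W); dyck P1; c0 P1 = 1\<rbrakk>
     \<Longrightarrow> tamari_cover (V @ [Down] @ P1 @ W) (V @ P1 @ [Down] @ W)"

definition tamari_le :: "step list \<Rightarrow> step list \<Rightarrow> bool" where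
  "tamari_le P Q \<longleftrightarrow> dyck P \<and> dyck Q \<and> length P = length Q \<and> tamari_cover\<^sup>*\<^sup>* P Q"

lemma finite_contacts [simp]: "finite (contacts P)"
  unfolding contacts_def by auto

lemma zero_in_contacts [simp]: "0 \<in> contacts P"
  by (simp add: contacts_def height_def)

lemma contacts_le_length: "k \<in> contacts P \<Longrightarrow> k \<le> length P"
  by (simp add: contacts_def)

text \<open>
  In the decomposition P1 u P2 d, the path P1 ends at the last contact before the end.
  Lemma \<open>conj_D_append\<close> below is the recursion in its usual form.
\<close>

function conj_D :: "step list \<Rightarrow> step list" where
  "conj_D P =
     (if P = [] then []
      else let k = Max (contacts (butlast P))
           in conj_D (drop (Suc k) (butlast P)) @ [Up] @ conj_D (take k P) @ [Down])"
  by pat_completeness auto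
termination
proof (relation "measure length")
  fix P :: "step list" and k
  assume P: "P \<noteq> []" and k: "k = Max (contacts (butlast P))"
  have "k \<in> contacts (butlast P)"
    unfolding k by (rule Max_in) (auto intro: zero_in_contacts)
  then have "k < length P"
    using contacts_le_length[of k "butlast P"] P by (cases P rule: rev_cases) auto
  then show "(take k P, P) \<in> measure length"
    by simp
qed auto

declare conj_D.simps [simp del]

lemma conj_D_Nil: "conj_D [] = []"
  by (simp add: conj_D.simps)

lemma height_append: "height (P @ Q) = height P + height Q"
  by (simp add: height_def)

lemma conj_D_append:
  assumes "dyck P1" and "dyck P2"
  shows "conj_D (P1 @ [Up] @ P2 @ [Down]) = conj_D P2 @ [Up] @ conj_D P1 @ [Down]"
proof -
  let ?B = "P1 @ [Up] @ P2"
  have "Max (contacts ?B) = length P1"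
  proof (rule Max_eqI)
    show "length P1 \<in> contacts ?B"
      using assms(1) by (simp add: contacts_def dyck_def)
  next
    fix k assume k: "k \<in> contacts ?B"
    show "k \<le> length P1"
    proof (rule ccontr)
      assume "\<not> k \<le> length P1"
      then obtain m where m: "k = length P1 + Suc m"
        by (metis add_Suc_right less_imp_Suc_add not_le)
      from k have "m \<le> length P2"
        by (simp add: contacts_def m)
      then have "0 \<le> height (take m P2)"
        using assms(2) by (simp add: dyck_def)
      moreover have "height (take k ?B) = height P1 + 1 + height (take m P2)"
        by (simp add: m height_def)
      moreover have "height (take k ?B) = 0"
        using k by (simp add: contacts_def)
      ultimately show False
        using assms(1) by (simp add: dyck_def)
    qed
  qed simp
  moreover have "butlast (P1 @ [Up] @ P2 @ [Down]) = ?B"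
    by (simp add: butlast_append)
  ultimately show ?thesis
    by (subst conj_D.simps) (simp add: Let_def)
qed


section \<open>Tamari intervals\<close>

type_synonym interval = "step list \<times> step list"

definition tamari_interval :: "interval \<Rightarrow> bool" where
  "tamari_interval I \<longleftrightarrow> tamari_le (fst I) (snd I)"

definition conj_I :: "interval \<Rightarrow> interval" where
  "conj_I I = (conj_D (snd I), conj_D (fst I))"

definition concat_I :: "interval \<Rightarrow> interval \<Rightarrow> interval" where
  "concat_I I1 I2 = (fst I1 @ fst I2, snd I1 @ snd I2)"

definition aug_I :: "nat \<Rightarrow> interval \<Rightarrow> interval" where
  "aug_I i I =
     (let (P, Q) = I; k = contact_from_right i P
      in ([Up] @ take k P @ [Down] @ drop k P, [Up] @ Q @ [Down]))"

definition oplus_I :: "interval \<Rightarrow> nat \<Rightarrow> interval \<Rightarrow> interval" where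
  "oplus_I I1 i I2 = concat_I (aug_I i I1) I2"


section \<open>Fighting fish\<close>

datatype letter = East | North | West | South | Vee

inductive fighting_fish :: "letter list \<Rightarrow> bool" where
  "fighting_fish [East, North, West, South]"
| "fighting_fish (X @ [West] @ Y) \<Longrightarrow> fighting_fish (X @ [North, West, South] @ Y)"
| "fighting_fish (X @ [North] @ Y) \<Longrightarrow> fighting_fish (X @ [East, North, West] @ Y)"
| "fighting_fish (X @ [West, North] @ Y) \<Longrightarrow> fighting_fish (X @ [North, West] @ Y)"

text \<open>Replacing some occurrences of the factor WN, which never overlap, by V.\<close>

inductive replace_WN :: "letter list \<Rightarrow> letter list \<Rightarrow> bool" where
  "replace_WN [] []"
| "replace_WN X Y \<Longrightarrow> replace_WN (x # X) (x # Y)"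
| "replace_WN X Y \<Longrightarrow> replace_WN (West # North # X) (Vee # Y)"

definition empty_fish :: "letter list" where
  "empty_fish = [East, Vee, South]"

definition extended_fish :: "letter list \<Rightarrow> bool" where
  "extended_fish F \<longleftrightarrow> F = empty_fish \<or> (\<exists>G. fighting_fish G \<and> replace_WN G F)"

text \<open>
  The operations below are total functions on words; they are meant for words satisfying
  \<open>extended_fish\<close>, and for \<open>aug_F\<close> with an index between 1 and the jaw length plus 1.
\<close>

primrec conj_letter :: "letter \<Rightarrow> letter" where
  "conj_letter East = South"
| "conj_letter South = East"
| "conj_letter North = West"
| "conj_letter West = North"
| "conj_letter Vee = Vee"

definition conj_F :: "letter list \<Rightarrow> letter list" where
  "conj_F F = map conj_letter (rev F)"

definition jaw :: "letter list \<Rightarrow> nat" where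
  "jaw F = (if F = empty_fish then 0 else length (takeWhile (\<lambda>x. x = East) F))"

definition concat_F :: "letter list \<Rightarrow> letter list \<Rightarrow> letter list" where
  "concat_F F1 F2 =
     (if F1 = empty_fish then F2
      else if F2 = empty_fish then F1
      else replicate (jaw F2) East @ butlast F1 @ drop (Suc (jaw F2)) F2)"

definition aug_F :: "nat \<Rightarrow> letter list \<Rightarrow> letter list" where
  "aug_F i F =
     (if F = empty_fish then [East, North, West, South]
      else let j = jaw F; G = drop (Suc j) F
           in if i \<le> j
              then replicate i East @ [North] @ replicate (j - i) East @ [North] @ G @ [South]
              else replicate (Suc j) East @ [North, Vee] @ G @ [South])"

definition oplus_F :: "letter list \<Rightarrow> nat \<Rightarrow> letter list \<Rightarrow> letter list" where
  "oplus_F F1 i F2 = concat_F (aug_F i F1) F2"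


section \<open>The map from Tamari intervals to extended fighting fish\<close>

text \<open>
  \<open>Phi_rel\<close> is the graph of the recursion. On Tamari intervals it is functional and total,
  because \<open>oplus_I\<close> is a bijection onto the non-empty intervals.
\<close>

inductive Phi_rel :: "interval \<Rightarrow> letter list \<Rightarrow> bool" where
  "Phi_rel ([], []) empty_fish"
| "\<lbrakk>tamari_interval I1; 1 \<le> i; i \<le> c0 (fst I1) + 1; tamari_interval I2;
    Phi_rel I1 F1; Phi_rel I2 F2\<rbrakk>
     \<Longrightarrow> Phi_rel (oplus_I I1 i I2) (oplus_F F1 i F2)"

definition Phi :: "interval \<Rightarrow> letter list" where
  "Phi I = (THE F. Phi_rel I F)"

end

theory Submission
  imports Defs
begin

text \<open>
  The recursion behind \<open>Phi\<close> peels an interval at the first return of its upper path and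
  ignores the symmetry of the problem; the proof replaces it by a formula that is symmetric.

  Read the lower path P as a plane forest below a virtual root, and let \<open>child_counts P\<close> be the
  numbers of children \<open>c\<^sub>0, \<dots>, c\<^sub>n\<close> of its vertices in prefix order. Let \<open>down_runs Q\<close> be the
  numbers \<open>d\<^sub>0 = 0, d\<^sub>1, \<dots>, d\<^sub>n\<close> of down steps that follow the successive up steps of the upper
  path Q. On a Tamari interval \<open>c\<^sub>k\<close> and \<open>d\<^sub>k\<close> are never both positive, and the fish is E, then one
  block for each k, then S; the block is \<open>E\<^bsup>c-1\<^esup>N\<close> if \<open>c = c\<^sub>k\<close> is positive, \<open>WS\<^bsup>d-1\<^esup>\<close> if
  \<open>d = d\<^sub>k\<close> is positive, and V if both vanish (\<open>Phi_eq_fish_word\<close>). The reason is that peeling the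
  first vertex of the forest does not change the number of children of any other vertex: its
  children merely move up to the virtual root, and their number is what the pointing records
  (\<open>fish_word_oplus\<close>). The recursion reaches every interval because
  an interval can be split at the first return of its upper path (\<open>tamari_le_first_return\<close>).

  Conjugation of Dyck paths exchanges the two lists and reverses them, which is how
  \<open>child_counts\<close> is introduced here. Conjugation of words reverses the order of the blocks
  and turns the block of \<open>(c, d)\<close> into the block of \<open>(d, c)\<close>. Since conjugation also reverses the
  Tamari order (\<open>tamari_le_conj_D\<close>), the conjugate pair is again an interval, to which the formula
  applies, and the first claim follows.

  In the formula the letters E and N depend on \<open>child_counts P\<close> alone, and summing over the vertices
  gives valleys and double rises of P. The letters W and S are the letters N and E of the
  conjugate fish, and conjugation exchanges valleys with double rises.
\<close>

section \<open>Dyck paths\<close>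

lemma height_simps [simp]:
  "height [] = 0" "height (Up # P) = height P + 1" "height (Down # P) = height P - 1"
  by (simp_all add: height_def)

declare height_append [simp]

text \<open>A walk started at height h stays weakly above the axis. The variable start makes the notion
  compatible with concatenation.\<close>
primrec above :: "int \<Rightarrow> step list \<Rightarrow> bool" where
  "above h [] \<longleftrightarrow> 0 \<le> h"
| "above h (x # P) \<longleftrightarrow> 0 \<le> h \<and> above (case x of Up \<Rightarrow> h + 1 | Down \<Rightarrow> h - 1) P"

lemma above_append [simp]: "above h (P @ Q) \<longleftrightarrow> above h P \<and> above (h + height P) Q"
proof (induction P arbitrary: h)
  case Nil
  then show ?case by (cases Q) auto
next
  case (Cons x P)
  then show ?case by (cases x) (auto simp: algebra_simps)
qed

lemma above_ends: "above h P \<Longrightarrow> 0 \<le> h \<and> 0 \<le> h + height P"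
proof (induction P arbitrary: h)
  case (Cons x P)
  then show ?case by (cases x) fastforce+
qed simp

lemma above_mono: "above h P \<Longrightarrow> h \<le> h' \<Longrightarrow> above h' P"
proof (induction P arbitrary: h h')
  case (Cons x P)
  show ?case
    using Cons.prems Cons.IH[of "h + 1" "h' + 1"] Cons.IH[of "h - 1" "h' - 1"] by (cases x) auto
qed simp

lemma above_iff_take: "above h P \<longleftrightarrow> (\<forall>k \<le> length P. 0 \<le> h + height (take k P))"
proof (induction P rule: rev_induct)
  case (snoc x P)
  have "(\<forall>k \<le> length (P @ [x]). 0 \<le> h + height (take k (P @ [x]))) \<longleftrightarrow>
    (\<forall>k \<le> length P. 0 \<le> h + height (take k P)) \<and> 0 \<le> h + height (P @ [x])"
    by (auto simp: le_Suc_eq)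
  then show ?case
    using snoc above_ends by (cases x) auto
qed simp

lemma dyck_iff_above: "dyck P \<longleftrightarrow> height P = 0 \<and> above 0 P"
  by (simp add: dyck_def above_iff_take)

lemma dyck_above: "dyck P \<Longrightarrow> 0 \<le> h \<Longrightarrow> above h P"
  using above_mono dyck_iff_above by blast

lemma dyck_height [simp]: "dyck P \<Longrightarrow> height P = 0"
  by (simp add: dyck_def)

lemma dyck_Nil [simp]: "dyck []"
  by (simp add: dyck_iff_above)

lemma dyck_append: "dyck P \<Longrightarrow> dyck Q \<Longrightarrow> dyck (P @ Q)"
  by (simp add: dyck_iff_above)

lemma dyck_append_iff: "height P = 0 \<Longrightarrow> dyck (P @ Q) \<longleftrightarrow> dyck P \<and> dyck Q"
  by (auto simp: dyck_iff_above)

lemma dyck_Up_Down: "dyck P \<Longrightarrow> dyck (Up # P @ [Down])"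
  by (simp add: dyck_iff_above above_mono[of 0 P 1])

text \<open>Cut before the last up step that leaves height 0.\<close>
lemma last_passage:
  assumes "above 0 P" "0 < height P"
  shows "\<exists>A B. P = A @ Up # B \<and> dyck A \<and> above 0 B"
  using assms
proof (induction P rule: rev_induct)
  case (snoc x P)
  show ?case
  proof (cases "0 < height P")
    case True
    then obtain A B where AB: "P = A @ Up # B" "dyck A" "above 0 B"
      using snoc by auto
    then have "above 0 (B @ [x])"
      using snoc.prems True AB above_ends[of 0 B] by (cases x) auto
    then show ?thesis
      using AB by (metis append.assoc append_Cons)
  next
    case False
    then have "height P = 0" "x = Up"
      using snoc.prems above_ends[of 0 P] by (cases x; auto)+
    then show ?thesis
      using snoc.prems by (intro exI[of _ P] exI[of _ "[]"]) (auto simp: dyck_iff_above)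
  qed
qed simp

text \<open>Cut before the first down step that crosses the axis.\<close>
lemma first_passage:
  assumes "\<not> above 0 P"
  shows "\<exists>A B. P = A @ Down # B \<and> dyck A"
  using assms
proof (induction P rule: rev_induct)
  case (snoc x P)
  show ?case
  proof (cases "above 0 P")
    case True
    then have "height P = 0" "x = Down"
      using snoc.prems above_ends[of 0 P] by (cases x; auto)+
    then show ?thesis
      using True by (auto simp: dyck_iff_above)
  next
    case False
    then obtain A B where "P = A @ Down # B" "dyck A"
      using snoc.IH by blast
    then show ?thesis by auto
  qed
qed simp

lemma dyck_first_return:
  assumes "dyck P" "P \<noteq> []"
  obtains A B where "P = Up # A @ Down # B" "dyck A" "dyck B"
proof -
  obtain R where R: "P = Up # R"
    using assms above_ends[of "-1"] by (cases P; cases "hd P") (auto simp: dyck_iff_above)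
  have "\<not> above 0 R"
    using assms R above_ends[of 0 R] by (auto simp: dyck_iff_above)
  then obtain A B where AB: "R = A @ Down # B" "dyck A"
    using first_passage by blast
  then have "dyck B"
    using assms R by (auto simp: dyck_iff_above)
  then show ?thesis
    using that AB R by simp
qed

lemma dyck_last_return:
  assumes "dyck P" "P \<noteq> []"
  obtains A B where "P = A @ [Up] @ B @ [Down]" "dyck A" "dyck B"
proof -
  obtain R x where R: "P = R @ [x]"
    using assms(2) by (cases P rule: rev_cases) auto
  have x: "x = Down" "height R = 1" "above 0 R"
    using assms(1) R above_ends[of 0 R] by (cases x; auto simp: dyck_iff_above)+
  then obtain A B where AB: "R = A @ Up # B" "dyck A" "above 0 B"
    using last_passage[of R] by auto
  then have "dyck B"
    using x by (auto simp: dyck_iff_above)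
  then show ?thesis
    using that AB R x by simp
qed

lemma dyck_induct [consumes 1, case_names Nil last_return]:
  assumes "dyck P" and "R []"
    and "\<And>A B. dyck A \<Longrightarrow> dyck B \<Longrightarrow> R A \<Longrightarrow> R B \<Longrightarrow> R (A @ [Up] @ B @ [Down])"
  shows "R P"
  using assms(1)
proof (induction "length P" arbitrary: P rule: less_induct)
  case less
  show ?case
  proof (cases "P = []")
    case False
    with less.prems obtain A B where "P = A @ [Up] @ B @ [Down]" "dyck A" "dyck B"
      by (rule dyck_last_return)
    then show ?thesis
      using less.hyps[of A] less.hyps[of B] assms(3) by auto
  qed (use assms(2) in simp)
qed

lemma conj_D_properties:
  assumes "dyck P"
  shows dyck_conj_D: "dyck (conj_D P)"
    and length_conj_D: "length (conj_D P) = length P"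
    and conj_D_conj_D: "conj_D (conj_D P) = P"
proof -
  have "dyck (conj_D P) \<and> length (conj_D P) = length P \<and> conj_D (conj_D P) = P"
    using assms
  proof (induction P rule: dyck_induct)
    case (last_return A B)
    then show ?case
      using dyck_append dyck_Up_Down[of "conj_D A"] conj_D_append[of A B]
        conj_D_append[of "conj_D B" "conj_D A"] by auto
  qed (simp add: conj_D_Nil)
  then show "dyck (conj_D P)" "length (conj_D P) = length P" "conj_D (conj_D P) = P"
    by auto
qed

subsection \<open>Contacts\<close>

text \<open>This count determines the index, from the right, of the contact that separates A from B.\<close>
lemma card_contacts_beyond:
  assumes "height A = 0"
  shows "card {k \<in> contacts (A @ B). length A < k} = c0 B"
proof -
  have "{k \<in> contacts (A @ B). length A < k} = (\<lambda>k. length A + k) ` (contacts B - {0})" (is "?L = ?R")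
  proof
    show "?R \<subseteq> ?L"
      using assms by (auto simp: contacts_def)
    show "?L \<subseteq> ?R"
    proof
      fix k assume "k \<in> ?L"
      then have "k = length A + (k - length A)" "k - length A \<in> contacts B - {0}"
        using assms by (auto simp: contacts_def)
      then show "k \<in> ?R" by blast
    qed
  qed
  then show ?thesis
    by (simp add: c0_def card_image)
qed

lemma c0_append:
  assumes "height A = 0"
  shows "c0 (A @ B) = c0 A + c0 B"
proof -
  have "contacts (A @ B) - {0} = (contacts A - {0}) \<union> {k \<in> contacts (A @ B). length A < k}"
    (is "?L = ?R")
  proof (rule set_eqI)
    fix k show "k \<in> ?L \<longleftrightarrow> k \<in> ?R"
      using assms by (cases "k \<le> length A") (auto simp: contacts_def)
  qed
  moreover have "(contacts A - {0}) \<inter> {k \<in> contacts (A @ B). length A < k} = {}"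
    using contacts_le_length by fastforce
  ultimately show ?thesis
    using card_contacts_beyond[OF assms] by (simp add: c0_def card_Un_disjoint)
qed

lemma c0_Nil [simp]: "c0 [] = 0"
  by (simp add: c0_def contacts_def)

lemma c0_Up_Down:
  assumes "dyck A"
  shows "c0 (Up # A @ [Down]) = 1"
proof -
  have "k \<notin> contacts (Up # A @ [Down])" if k: "0 < k" "k \<le> Suc (length A)" for k
  proof -
    obtain m where m: "k = Suc m" using k by (cases k) auto
    then have "m \<le> length A"
      using k by simp
    then have "0 \<le> height (take m A)"
      using assms unfolding dyck_def by blast
    then show ?thesis
      using k m by (simp add: contacts_def)
  qed
  moreover have "Suc (Suc (length A)) \<in> contacts (Up # A @ [Down])"
    using assms by (simp add: contacts_def)
  moreover have "k \<le> Suc (Suc (length A))" if "k \<in> contacts (Up # A @ [Down])" for k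
    using contacts_le_length[OF that] by simp
  ultimately have "k \<in> contacts (Up # A @ [Down]) - {0} \<longleftrightarrow> k = Suc (Suc (length A))" for k
    by (metis DiffE DiffI Zero_not_Suc gr0I le_SucE singletonD singletonI)
  then have "contacts (Up # A @ [Down]) - {0} = {Suc (Suc (length A))}"
    by blast
  then show ?thesis
    by (simp add: c0_def)
qed

lemma card_contacts: "card (contacts P) = c0 P + 1"
  unfolding c0_def using card_Suc_Diff1[OF finite_contacts zero_in_contacts]
  by (metis Suc_eq_plus1)

lemma c0_eq_0_iff: "dyck P \<Longrightarrow> c0 P = 0 \<longleftrightarrow> P = []"
proof
  assume "dyck P" "c0 P = 0"
  then have "card (contacts P) = 1" "{0, length P} \<subseteq> contacts P"
    by (simp_all add: card_contacts) (simp add: contacts_def)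
  then show "P = []"
    by (metis card_1_singletonE insert_subset length_0_conv singletonD)
qed simp

lemma primitive_dyck:
  assumes "dyck P" "c0 P = 1"
  obtains A where "P = Up # A @ [Down]" "dyck A"
proof -
  have "P \<noteq> []" using assms by auto
  then obtain A B where AB: "P = Up # A @ Down # B" "dyck A" "dyck B"
    using assms(1) dyck_first_return by blast
  then have "c0 P = 1 + c0 B"
    using c0_append[of "Up # A @ [Down]" B] c0_Up_Down[of A] by simp
  then show ?thesis
    using assms AB c0_eq_0_iff that by simp
qed

lemma card_greater_nth_of_decreasing:
  assumes "sorted_wrt (>) (ys :: nat list)" "j < length ys"
  shows "card {c \<in> set ys. ys ! j < c} = j"
proof -
  have less: "ys ! j < ys ! k \<longleftrightarrow> k < j" if "k < length ys" for k
    using sorted_wrt_nth_less[OF assms(1), of j k] sorted_wrt_nth_less[OF assms(1), of k j]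
      assms(2) that by (cases k j rule: linorder_cases) auto
  have "{c \<in> set ys. ys ! j < c} = (!) ys ` {..<j}"
  proof (rule subset_antisym; rule subsetI)
    fix c assume "c \<in> {c \<in> set ys. ys ! j < c}"
    then show "c \<in> (!) ys ` {..<j}"
      using less by (auto simp: in_set_conv_nth)
  next
    fix c assume "c \<in> (!) ys ` {..<j}"
    then obtain k where "c = ys ! k" "k < j" by auto
    then show "c \<in> {c \<in> set ys. ys ! j < c}"
      using less[of k] assms(2) by simp
  qed
  moreover have "distinct ys"
    using assms(1) by (induction ys) auto
  then have "inj_on ((!) ys) {..<j}"
    using assms(2) by (intro inj_on_nth) auto
  ultimately show ?thesis
    by (simp add: card_image)
qed

lemma decreasing_contacts: "sorted_wrt (>) (rev (sorted_list_of_set (contacts P)))"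
  by (simp add: sorted_wrt_rev)

text \<open>The next two lemmas turn the pointing of a path by the index of a contact into a
  factorisation, and back.\<close>
lemma contact_split:
  assumes "dyck P" "1 \<le> i" "i \<le> c0 P + 1"
  obtains A B where "P = A @ B" "dyck A" "dyck B" "i = c0 B + 1"
    "contact_from_right i P = length A"
proof -
  let ?ys = "rev (sorted_list_of_set (contacts P))"
  let ?k = "contact_from_right i P"
  have len: "i - 1 < length ?ys"
    using assms card_contacts[of P] by simp
  have k: "?k \<in> contacts P"
    using nth_mem[OF len] by (simp add: contact_from_right_def)
  have i: "card {c \<in> contacts P. ?k < c} = i - 1"
    using card_greater_nth_of_decreasing[OF decreasing_contacts len]
    by (simp add: contact_from_right_def)
  define A B where "A = take ?k P" and "B = drop ?k P"
  have P: "P = A @ B" and A: "length A = ?k" "height A = 0"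
    using k by (auto simp: A_def B_def contacts_def)
  have "c0 B = i - 1"
    using card_contacts_beyond[OF A(2), of B] i A(1) P by simp
  moreover have "dyck A \<and> dyck B"
    using assms(1) P A dyck_append_iff by blast
  ultimately show ?thesis
    using that P A assms(2) by auto
qed

lemma contact_from_right_append:
  assumes "dyck A" "dyck B"
  shows "contact_from_right (c0 B + 1) (A @ B) = length A"
proof -
  let ?ys = "rev (sorted_list_of_set (contacts (A @ B)))"
  have "length A \<in> set ?ys"
    using assms by (simp add: contacts_def)
  then obtain j where j: "j < length ?ys" "?ys ! j = length A"
    by (metis in_set_conv_nth)
  then have "j = c0 B"
    using card_greater_nth_of_decreasing[OF decreasing_contacts j(1)]
      card_contacts_beyond[of A B] assms by simp
  then show ?thesis
    using j by (simp add: contact_from_right_def)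
qed

section \<open>The Tamari order\<close>

lemma tamari_cover_context:
  assumes "tamari_cover P Q" "dyck (X @ P @ Y)"
  shows "tamari_cover (X @ P @ Y) (X @ Q @ Y)"
  using assms(1)
proof cases
  case (1 V R W)
  then show ?thesis
    using assms(2) tamari_cover.intros[of "X @ V" R "W @ Y"] by simp
qed

text \<open>Conditions on V and W alone, so that either of them can be cut without a new look at the
  rotated factor.\<close>
lemma dyck_rotate_iff:
  assumes "dyck R"
  shows "dyck (V @ Down # Up # R @ Down # W) \<longleftrightarrow>
    above 0 V \<and> 1 \<le> height V \<and> above (height V - 1) W \<and> height V + height W = 1"
proof (cases "1 \<le> height V")
  case True
  then have "above (height V) R"
    using dyck_above[OF assms] by simp
  then show ?thesis
    using True assms by (simp add: dyck_iff_above) linarith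
next
  case False
  then have "\<not> above (height V) (Down # Y)" for Y
    using above_ends[of "height V - 1" Y] by auto
  then show ?thesis
    using False by (simp add: dyck_iff_above del: above.simps(2))
qed

lemma tamari_coverE:
  assumes "tamari_cover P Q"
  obtains V R W where "P = V @ Down # Up # R @ Down # W" "Q = V @ Up # R @ Down # Down # W"
    "dyck R" "above 0 V" "1 \<le> height V" "above (height V - 1) W" "height V + height W = 1"
  using assms
proof cases
  case (1 V R' W)
  obtain R where R: "R' = Up # R @ [Down]" "dyck R"
    using 1(4,5) by (rule primitive_dyck)
  then show ?thesis
    using that[of V R W] 1 dyck_rotate_iff[of R V W] by simp
qed

lemma tamari_coverI:
  assumes "dyck R" "above 0 V" "1 \<le> height V" "above (height V - 1) W" "height V + height W = 1"
  shows "tamari_cover (V @ Down # Up # R @ Down # W) (V @ Up # R @ Down # Down # W)"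
  using tamari_cover.intros[of V "Up # R @ [Down]" W] assms dyck_rotate_iff[of R V W]
    dyck_Up_Down c0_Up_Down by auto

lemma tamari_cover_dyck:
  assumes "tamari_cover P Q"
  shows "dyck P" "dyck Q" "length P = length Q"
proof -
  obtain V R W where *: "P = V @ Down # Up # R @ Down # W" "Q = V @ Up # R @ Down # Down # W"
    "dyck R" "above 0 V" "1 \<le> height V" "above (height V - 1) W" "height V + height W = 1"
    using assms by (rule tamari_coverE)
  then show "dyck P" "length P = length Q"
    using dyck_rotate_iff by auto
  show "dyck Q"
    using *(3-) dyck_above[of R "height V + 1"] unfolding *(2) by (simp add: dyck_iff_above)
qed

lemma tamari_le_refl: "dyck P \<Longrightarrow> tamari_le P P"
  by (simp add: tamari_le_def)

lemma tamari_cover_le_trans: "tamari_cover P P' \<Longrightarrow> tamari_le P' Q \<Longrightarrow> tamari_le P Q"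
  using tamari_cover_dyck[of P P'] by (simp add: tamari_le_def converse_rtranclp_into_rtranclp)

lemma tamari_le_induct [consumes 1, case_names refl step]:
  assumes "tamari_le P Q" and "R Q"
    and "\<And>P P'. tamari_cover P P' \<Longrightarrow> tamari_le P' Q \<Longrightarrow> R P' \<Longrightarrow> R P"
  shows "R P"
proof -
  have Q: "dyck Q" and "tamari_cover\<^sup>*\<^sup>* P Q"
    using assms(1) by (auto simp: tamari_le_def)
  from this(2) have "tamari_le P Q \<and> R P"
    by (induction rule: converse_rtranclp_induct)
       (auto intro: assms(2,3) tamari_le_refl Q tamari_cover_le_trans)
  then show ?thesis ..
qed

subsection \<open>Conjugation reverses the order\<close>

text \<open>
  In terms of binary trees, with left subtree A and right subtree B, a cover is a rotation, and it
  takes place inside one of the two subtrees or at the root. In the last case the moved factor is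
  the final arch, and the down step before it ends A.
\<close>
lemma tamari_cover_last_return_cases:
  assumes "tamari_cover (A @ [Up] @ B @ [Down]) Q" "dyck A" "dyck B"
  obtains
    (left) A' where "tamari_cover A A'" "Q = A' @ [Up] @ B @ [Down]"
  | (right) B' where "tamari_cover B B'" "Q = A @ [Up] @ B' @ [Down]"
  | (root) L M where "dyck L" "dyck M" "A = L @ [Up] @ M @ [Down]"
      "Q = L @ [Up] @ (M @ [Up] @ B @ [Down]) @ [Down]"
proof -
  obtain V R W where *: "A @ [Up] @ B @ [Down] = V @ Down # Up # R @ Down # W"
      "Q = V @ Up # R @ Down # Down # W" "dyck R"
    and V: "above 0 V" "1 \<le> height V" "above (height V - 1) W" "height V + height W = 1"
    using assms(1) by (rule tamari_coverE)
  \<comment> \<open>position of the up step after A relative to the moved factor\<close>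
  have "(\<exists>Z. V = A @ Up # Z) \<or> (V @ [Down] = A) \<or> (\<exists>Z. A = V @ Down # Up # Z)"
  proof -
    have "A @ (Up # B @ [Down]) = V @ (Down # Up # R @ Down # W)" using *(1) by simp
    then consider Z where "A = V @ Z" "Z @ Up # B @ [Down] = Down # Up # R @ Down # W"
      | Z where "V = A @ Z" "Up # B @ [Down] = Z @ Down # Up # R @ Down # W"
      unfolding append_eq_append_conv2 by blast
    then show ?thesis
      by cases (auto simp: Cons_eq_append_conv append_eq_Cons_conv)
  qed
  then consider Z where "V = A @ Up # Z" | "A = V @ [Down]" | Z where "A = V @ Down # Up # Z"
    by blast
  then show thesis
  proof cases
    case 1
    show thesis
    proof (cases W rule: rev_cases)
      case Nil
      have "B = Z @ Down # Up # R"
        using *(1) 1 Nil by simp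
      moreover have "height Z = 0" using V(4) Nil 1 assms(2) by simp
      ultimately have False
        using assms(3) above_ends[of "-1" "Up # R"] by (simp add: dyck_iff_above)
      then show thesis ..
    next
      case (snoc W' x)
      then have "B = Z @ Down # Up # R @ Down # W'" "x = Down"
        using *(1) 1 by auto
      then show thesis
        using right[of "Z @ Up # R @ Down # Down # W'"] *(2,3) 1 snoc assms(2,3)
          tamari_coverI[of R Z W'] dyck_rotate_iff[of R Z W'] by simp
    qed
  next
    case 2
    then have "Up # B @ [Down] = Up # R @ Down # W"
      using *(1) by simp
    then have RB: "B @ [Down] = R @ Down # W" by simp
    have "W = []"
    proof (cases W rule: rev_cases)
      case (snoc W' x)
      then have "B = R @ Down # W'" using RB by simp
      then show ?thesis
        using assms(3) *(3) above_ends[of "-1" W'] by (simp add: dyck_iff_above)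
    qed simp
    then have "B = R" using RB by simp
    obtain L M where "V @ [Down] = L @ [Up] @ M @ [Down]" "dyck L" "dyck M"
      using dyck_last_return[OF assms(2)] 2 by auto
    then show thesis
      using root[of L M] 2 *(2) \<open>W = []\<close> \<open>B = R\<close> by simp
  next
    case 3
    then have e: "Z @ Up # B @ [Down] = R @ Down # W"
      using *(1) by simp
    then consider Y where "Z = R @ Y" "Y @ Up # B @ [Down] = Down # W"
      | Y where "R = Z @ Y" "Up # B @ [Down] = Y @ Down # W"
      unfolding append_eq_append_conv2 by blast
    then show thesis
    proof cases
      case 1
      then obtain Y' where "Z = R @ Down # Y'" "W = Y' @ Up # B @ [Down]"
        by (cases Y) auto
      then show thesis
        using left[of "V @ Up # R @ Down # Down # Y'"] *(2,3) 3 assms(2)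
          tamari_coverI[of R V Y'] dyck_rotate_iff[of R V Y'] by simp
    next
      case 2
      have "height A = 0" using assms(2) by simp
      then have "height Z < 0" using V unfolding 3 by simp
      then show thesis
        using 2 *(3) above_ends[of 0 Z] by (auto simp: dyck_iff_above)
    qed
  qed
qed

text \<open>Conjugation mirrors the binary tree, and the mirror image of a rotation is a rotation in the
  opposite direction.\<close>
lemma tamari_cover_conj_D:
  assumes "dyck P" "tamari_cover P Q"
  shows "tamari_cover (conj_D Q) (conj_D P)"
  using assms
proof (induction P arbitrary: Q rule: dyck_induct)
  case Nil
  then show ?case by (auto elim: tamari_coverE)
next
  case (last_return A B)
  from last_return.prems last_return.hyps show ?case
  proof (cases rule: tamari_cover_last_return_cases)
    case (left A')
    have "dyck A'" using left tamari_cover_dyck by blast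
    then show ?thesis
      using left last_return dyck_append[OF dyck_conj_D dyck_Up_Down[OF dyck_conj_D], of B A']
        tamari_cover_context[of "conj_D A'" "conj_D A" "conj_D B @ [Up]" "[Down]"]
        conj_D_append[of A B] conj_D_append[of A' B] by simp
  next
    case (right B')
    have "dyck B'" using right tamari_cover_dyck by blast
    then show ?thesis
      using right last_return dyck_append[OF dyck_conj_D dyck_Up_Down[OF dyck_conj_D], of B' A]
        tamari_cover_context[of "conj_D B'" "conj_D B" "[]" "Up # conj_D A @ [Down]"]
        conj_D_append[of A B] conj_D_append[of A B'] by simp
  next
    case (root L M)
    have "dyck (conj_D B)" "dyck (conj_D M)" "dyck (conj_D L)"
      using last_return.hyps root dyck_conj_D by auto
    then show ?thesis
      using root last_return.hyps dyck_above[of "conj_D M" 1] dyck_append[of M "Up # B @ [Down]"] dyck_Up_Down[of B]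
        dyck_append[of L "Up # M @ [Down]"] dyck_Up_Down[of M]
        tamari_coverI[of "conj_D L" "conj_D B @ Up # conj_D M" "[]"]
        conj_D_append[of A B] conj_D_append[of L M] conj_D_append[of L "M @ [Up] @ B @ [Down]"]
        conj_D_append[of M B]
      by (simp add: dyck_iff_above)
  qed
qed

lemma tamari_le_conj_D:
  assumes "tamari_le P Q"
  shows "tamari_le (conj_D Q) (conj_D P)"
proof -
  have PQ: "dyck P" "dyck Q" "length P = length Q" "tamari_cover\<^sup>*\<^sup>* P Q"
    using assms by (auto simp: tamari_le_def)
  have "tamari_cover\<^sup>*\<^sup>* (conj_D Q) (conj_D P)"
    using PQ(4)
  proof (induction rule: converse_rtranclp_induct)
    case (step P P')
    then show ?case
      by (meson rtranclp.rtrancl_into_rtrancl tamari_cover_conj_D tamari_cover_dyck(1))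
  qed simp
  then show ?thesis
    using PQ dyck_conj_D length_conj_D by (simp add: tamari_le_def)
qed

subsection \<open>Splitting an interval at the first return of its upper path\<close>

text \<open>
  Undoing a cover moves a down step to the left across the arch before it. The down step starts at
  height at least 1 and the arch stays weakly above that height, so that the contact between X
  and Y cannot lie within the factor that changes.
\<close>
lemma tamari_cover_to_append_cases:
  assumes "tamari_cover P (X @ Y)" "dyck X" "dyck Y"
  obtains (left) X' where "tamari_cover X' X" "P = X' @ Y"
  | (right) Y' where "tamari_cover Y' Y" "P = X @ Y'"
proof -
  obtain V R W where *: "P = V @ Down # Up # R @ Down # W" "X @ Y = V @ Up # R @ Down # Down # W"
    "dyck R"
    and V: "above 0 V" "1 \<le> height V" "above (height V - 1) W" "height V + height W = 1"
    using assms(1) by (rule tamari_coverE)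
  have "X @ Y = (V @ Up # R @ [Down]) @ Down # W" using *(2) by simp
  then consider Z where "X = (V @ Up # R @ [Down]) @ Z" "Z @ Y = Down # W"
    | Z where "V @ Up # R @ [Down] = X @ Z" "Y = Z @ Down # W"
    using append_eq_append_conv2[of X Y "V @ Up # R @ [Down]" "Down # W"] by metis
  then show thesis
  proof cases
    case 1
    show thesis
    proof (cases Z)
      case Nil
      have "height X = 0" using assms(2) by simp
      then have False using V(2) *(3) unfolding 1(1) Nil by simp
      then show thesis ..
    next
      case (Cons z Z')
      then have X: "X = V @ Up # R @ Down # Down # Z'" "W = Z' @ Y"
        using 1 by auto
      have "height Z' = height W" "above (height V - 1) Z'"
        using V(3) assms(3) unfolding X(2) by simp_all
      then have "tamari_cover (V @ Down # Up # R @ Down # Z') X"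
        using V *(3) unfolding X(1) by (intro tamari_coverI) simp_all
      moreover have "P = (V @ Down # Up # R @ Down # Z') @ Y"
        using *(1) unfolding X(2) by simp
      ultimately show thesis by (rule left)
    qed
  next
    case 2
    then consider Z' where "V = X @ Z'" "Z' @ Up # R @ [Down] = Z"
      | Z' where "X = V @ Z'" "Up # R @ [Down] = Z' @ Z"
      unfolding append_eq_append_conv2 by blast
    then show thesis
    proof cases
      case 1
      have Y: "Y = Z' @ Up # R @ Down # Down # W"
        using 2(2) unfolding 1(2)[symmetric] by simp
      have "tamari_cover (Z' @ Down # Up # R @ Down # W) Y"
        using V assms(2) *(3) unfolding 1(1) Y by (intro tamari_coverI) simp_all
      moreover have "P = X @ (Z' @ Down # Up # R @ Down # W)"
        using *(1) unfolding 1(1) by simp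
      ultimately show thesis by (rule right)
    next
      case b: 2
      have "height X = 0" using assms(2) by simp
      then have "height Z' < 0" using V(2) unfolding b(1) by simp
      moreover have "above 0 (Z' @ Z)"
        using dyck_Up_Down[OF *(3)] unfolding dyck_iff_above b(2) by simp
      ultimately show thesis
        using above_ends[of 0 Z'] by simp
    qed
  qed
qed

text \<open>If the moved down step is the closing one, the last arch of A leaves the outer arch.\<close>
lemma tamari_cover_to_first_return_cases:
  assumes "tamari_cover P (Up # A @ [Down])" "dyck A"
  obtains (inside) A' where "tamari_cover A' A" "P = Up # A' @ [Down]"
  | (closing) A' R where "dyck A'" "dyck R" "A = A' @ R" "P = Up # A' @ [Down] @ R"
proof -
  obtain V R W where *: "P = V @ Down # Up # R @ Down # W"
    "Up # A @ [Down] = V @ Up # R @ Down # Down # W" "dyck R"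
    and V: "above 0 V" "1 \<le> height V" "above (height V - 1) W" "height V + height W = 1"
    using assms(1) by (rule tamari_coverE)
  then obtain V' where V': "V = Up # V'"
    using *(2) by (cases V) auto
  then have A: "A @ [Down] = V' @ Up # R @ Down # Down # W"
    using *(2) by simp
  show thesis
  proof (cases W rule: rev_cases)
    case Nil
    then have "A = V' @ Up # R @ [Down]" using A by simp
    moreover have "dyck (Up # R @ [Down])"
      using *(3) by (rule dyck_Up_Down)
    moreover from this have "dyck V'"
      using calculation assms(2) V(4) V' Nil by (simp add: dyck_iff_above)
    ultimately show thesis
      using closing[of V' "Up # R @ [Down]"] *(1) V' Nil by simp
  next
    case (snoc W' x)
    then have A': "A = V' @ Up # R @ Down # Down # W'" "x = Down"
      using A by auto
    have "above 0 V'" "above (height V' - 1) W'" "height V' + height W' = 1" "1 \<le> height V'"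
      using assms(2) *(3) above_ends[of "height V' - 1" W'] unfolding A'(1)
      by (auto simp: dyck_iff_above)
    then show thesis
      using inside[of "V' @ Down # Up # R @ Down # W'"] A' V' snoc *(1,3)
        tamari_coverI[of R V' W'] by simp
  qed
qed

text \<open>
  Going down from \<open>uQ\<^sub>1dQ\<^sub>2\<close> by covers, the down step that closes the first arch can only travel to
  the left across arches at the end of the inner path. This leaves the product \<open>AB\<close> unchanged and
  never affects the contact before \<open>P\<^sub>2\<close>; every other cover acts in A, in B or in \<open>P\<^sub>2\<close>.
\<close>
lemma tamari_le_first_return:
  assumes "tamari_le P (Up # Q1 @ [Down] @ Q2)" "dyck Q1" "dyck Q2"
  shows "\<exists>A B P2. P = Up # A @ [Down] @ B @ P2 \<and> dyck A \<and> dyck B \<and>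
    tamari_le (A @ B) Q1 \<and> tamari_le P2 Q2"
  using assms(1)
proof (induction rule: tamari_le_induct)
  case refl
  show ?case
    using assms(2,3) tamari_le_refl by (intro exI[of _ Q1] exI[of _ "[]"] exI[of _ Q2]) auto
next
  case (step P P')
  then obtain A B P2 where *: "P' = Up # A @ [Down] @ B @ P2" "dyck A" "dyck B"
    "tamari_le (A @ B) Q1" "tamari_le P2 Q2"
    by blast
  have "dyck P2" using *(5) by (simp add: tamari_le_def)
  have "tamari_cover P ((Up # A @ [Down]) @ (B @ P2))" "dyck (Up # A @ [Down])" "dyck (B @ P2)"
    using step(1) * dyck_Up_Down dyck_append \<open>dyck P2\<close> by auto
  then show ?case
  proof (cases rule: tamari_cover_to_append_cases)
    case (left X')
    from left(1) \<open>dyck A\<close> show ?thesis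
    proof (cases rule: tamari_cover_to_first_return_cases)
      case (inside A')
      have "tamari_cover (A' @ B) (A @ B)"
        using inside(1) *(3) tamari_cover_context[of A' A "[]" B] tamari_cover_dyck(1) dyck_append
        by auto
      then have "tamari_le (A' @ B) Q1"
        using *(4) tamari_cover_le_trans by blast
      moreover have "dyck A'" using inside tamari_cover_dyck by blast
      ultimately show ?thesis
        using left(2) inside * by auto
    next
      case (closing A' R)
      then show ?thesis
        using left(2) * dyck_append[of R B]
        by (intro exI[of _ A'] exI[of _ "R @ B"] exI[of _ P2]) auto
    qed
  next
    case (right Y')
    from right(1) \<open>dyck B\<close> \<open>dyck P2\<close> show ?thesis
    proof (cases rule: tamari_cover_to_append_cases)
      case (left B')
      have "tamari_cover (A @ B') (A @ B)"
        using left(1) *(2) tamari_cover_context[of B' B A "[]"] tamari_cover_dyck(1) dyck_append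
        by auto
      then have "tamari_le (A @ B') Q1"
        using *(4) tamari_cover_le_trans by blast
      moreover have "dyck B'" using left tamari_cover_dyck by blast
      ultimately show ?thesis
        using left right * by auto
    next
      case R: (right P2')
      then have "tamari_le P2' Q2"
        using *(5) tamari_cover_le_trans by blast
      then show ?thesis
        using R right * by auto
    qed
  qed
qed

section \<open>Runs of down steps and numbers of children\<close>

text \<open>The head is the length of the initial run, which is empty for a Dyck path. With this extra
  entry the list matches \<open>child_counts\<close>, whose head belongs to the virtual root.\<close>
primrec down_runs :: "step list \<Rightarrow> nat list" where
  "down_runs [] = [0]"
| "down_runs (x # P) = (case x of
      Up \<Rightarrow> 0 # down_runs P
    | Down \<Rightarrow> Suc (hd (down_runs P)) # tl (down_runs P))"

lemma down_runs_neq_Nil [simp]: "down_runs P \<noteq> []"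
  by (cases P; cases "hd P") auto

lemma down_runs_append:
  "down_runs (P @ Q) =
    butlast (down_runs P) @ (last (down_runs P) + hd (down_runs Q)) # tl (down_runs Q)"
proof (induction P)
  case (Cons x P)
  then show ?case
    by (cases x; cases "down_runs P") auto
qed simp

lemma length_down_runs: "length (down_runs P) = Suc (count_list P Up)"
proof (induction P)
  case (Cons x P)
  then show ?case by (cases x) auto
qed simp

lemma hd_down_runs_dyck:
  assumes "dyck P"
  shows "hd (down_runs P) = 0"
  using assms above_ends[of "-1"] by (cases P; cases "hd P") (auto simp: dyck_iff_above)

lemma last_down_runs_dyck:
  assumes "dyck P" "P \<noteq> []"
  shows "0 < last (down_runs P)"
proof -
  obtain A B where "P = (A @ [Up] @ B) @ [Down]"
    using assms by (rule dyck_last_return) simp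
  then show ?thesis
    by (simp only: down_runs_append) simp
qed

lemma down_runs_last_return:
  "down_runs (A @ [Up] @ B @ [Down]) =
    down_runs A @ butlast (down_runs B) @ [Suc (last (down_runs B))]"
proof -
  have "down_runs (Up # B @ [Down]) = 0 # butlast (down_runs B) @ [Suc (last (down_runs B))]"
    by (simp add: down_runs_append)
  then show ?thesis
    using down_runs_append[of A "Up # B @ [Down]"] append_butlast_last_id[of "down_runs A"] by simp
qed

lemma down_runs_first_return:
  assumes "dyck Q2"
  shows "down_runs (Up # Q1 @ [Down] @ Q2) =
    0 # (butlast (down_runs Q1) @ [Suc (last (down_runs Q1))]) @ tl (down_runs Q2)"
  using down_runs_append[of Q1 "Down # Q2"] hd_down_runs_dyck[OF assms] by simp

text \<open>
  The numbers of children in the plane forest of P, in prefix order and starting with the virtual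
  root; the lemma \<open>child_counts_first_return\<close> below is the recursion along that traversal. The
  definition by conjugation makes the symmetry between the two lists immediate.
\<close>
definition child_counts :: "step list \<Rightarrow> nat list" where
  "child_counts P = rev (down_runs (conj_D P))"

lemma child_counts_neq_Nil [simp]: "child_counts P \<noteq> []"
  by (simp add: child_counts_def)

lemma child_counts_Nil: "child_counts [] = [0]"
  by (simp add: child_counts_def conj_D_Nil)

lemma child_counts_last_return:
  assumes "dyck A" "dyck B"
  shows "child_counts (A @ [Up] @ B @ [Down]) = Suc (hd (child_counts A)) # tl (child_counts A) @ child_counts B"
proof -
  have "rev (butlast xs @ [Suc (last xs)]) = Suc (hd (rev xs)) # tl (rev xs)" if "xs \<noteq> []"
    for xs :: "nat list"
    using that by (cases xs rule: rev_cases) auto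
  then show ?thesis
    using conj_D_append[OF assms] down_runs_last_return[of "conj_D B" "conj_D A"]
    by (simp add: child_counts_def)
qed

lemma child_counts_conj_D: "dyck P \<Longrightarrow> child_counts (conj_D P) = rev (down_runs P)"
  by (simp add: child_counts_def conj_D_conj_D)

lemma hd_child_counts:
  assumes "dyck P"
  shows "hd (child_counts P) = c0 P"
  using assms
proof (induction P rule: dyck_induct)
  case (last_return A B)
  then show ?case
    using c0_append[of A "Up # B @ [Down]"] c0_Up_Down[of B] child_counts_last_return[of A B] by simp
qed (simp add: child_counts_Nil)

lemma last_child_counts: "dyck P \<Longrightarrow> last (child_counts P) = 0"
  by (simp add: child_counts_def last_rev hd_down_runs_dyck dyck_conj_D)

lemma child_counts_append:
  assumes "dyck A" "dyck B"
  shows "child_counts (A @ B) = (c0 A + c0 B) # tl (child_counts A) @ tl (child_counts B)"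
  using assms(2)
proof (induction B rule: dyck_induct)
  case Nil
  then show ?case
    using hd_child_counts[OF assms(1)] hd_Cons_tl[of "child_counts A"] by (simp add: child_counts_Nil)
next
  case (last_return B C)
  have "child_counts ((A @ B) @ [Up] @ C @ [Down]) =
      Suc (hd (child_counts (A @ B))) # tl (child_counts (A @ B)) @ child_counts C"
    using last_return assms(1) dyck_append by (intro child_counts_last_return)
  then show ?case
    using last_return child_counts_last_return[of B C]
      c0_append[of B "Up # C @ [Down]"] c0_Up_Down[of C] by simp
qed

text \<open>The entries for the pair \<open>AB\<close> and for \<open>P\<^sub>2\<close> reappear unchanged, except for those of the virtual
  roots; the second entry belongs to the new vertex, whose children are the arches of A.\<close>
lemma child_counts_first_return:
  assumes "dyck A" "dyck B" "dyck P2"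
  shows "child_counts (Up # A @ [Down] @ B @ P2) =
    (c0 B + 1 + c0 P2) # c0 A # tl (child_counts (A @ B)) @ tl (child_counts P2)"
proof -
  have "child_counts (Up # A @ [Down]) = 1 # child_counts A"
    using child_counts_last_return[of "[]" A] assms(1) by (simp add: child_counts_Nil)
  moreover have "child_counts A = c0 A # tl (child_counts A)"
    using hd_child_counts[OF assms(1)] hd_Cons_tl[of "child_counts A"] by simp
  ultimately have "child_counts (Up # A @ [Down]) = 1 # c0 A # tl (child_counts A)" by simp
  moreover have "dyck (Up # A @ [Down])" "dyck (B @ P2)"
    using assms dyck_Up_Down dyck_append by auto
  ultimately show ?thesis
    using child_counts_append[of "Up # A @ [Down]" "B @ P2"] child_counts_append[of A B]
      child_counts_append[of B P2] c0_append[of B P2] c0_Up_Down[of A] assms by simp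
qed

section \<open>The fish of an interval\<close>

definition vertex_code :: "nat \<Rightarrow> nat \<Rightarrow> letter list" where
  "vertex_code c d =
     (if 0 < c then replicate (c - 1) East @ [North]
      else if 0 < d then West # replicate (d - 1) South
      else [Vee])"

text \<open>For the two lists of an interval this means that a vertex whose up step is followed by a down
  step in the upper path is a leaf of the lower forest.\<close>
definition compatible :: "nat list \<Rightarrow> nat list \<Rightarrow> bool" where
  "compatible cs ds \<longleftrightarrow> list_all2 (\<lambda>c d. c = 0 \<or> d = 0) cs ds"

definition fish_word :: "nat list \<Rightarrow> nat list \<Rightarrow> letter list" where
  "fish_word cs ds = East # concat (map2 vertex_code cs ds) @ [South]"

lemma conj_vertex_code: "c = 0 \<or> d = 0 \<Longrightarrow> conj_F (vertex_code c d) = vertex_code d c"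
  by (auto simp: conj_F_def vertex_code_def)

lemma conj_F_append: "conj_F (F @ G) = conj_F G @ conj_F F"
  by (simp add: conj_F_def)

lemma conj_fish_word:
  assumes "compatible cs ds"
  shows "conj_F (fish_word cs ds) = fish_word (rev ds) (rev cs)"
proof -
  have "conj_F (concat (map2 vertex_code cs ds)) = concat (map2 vertex_code (rev ds) (rev cs))"
    using assms unfolding compatible_def
  proof (induction rule: list_all2_induct)
    case Nil
    then show ?case by (simp add: conj_F_def)
  next
    case (Cons c cs d ds)
    then show ?case
      using list_all2_lengthD[OF Cons.hyps(2)] by (simp add: conj_F_append conj_vertex_code)
  qed
  then show ?thesis
    by (simp add: fish_word_def conj_F_def)
qed

text \<open>For words of this form, augmentation and concatenation act on the pair (j, M) by simple
  formulas; jaw length 0 stands for the empty fish.\<close>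
definition fish_shape :: "nat \<Rightarrow> letter list \<Rightarrow> letter list" where
  "fish_shape j M =
     (if j = 0 then empty_fish else replicate j East @ [North] @ M @ [South])"

lemma fish_shape_neq_empty_fish: "0 < j \<Longrightarrow> fish_shape j M \<noteq> empty_fish"
  by (cases j; cases "j - 1") (auto simp: fish_shape_def empty_fish_def)

lemma jaw_fish_shape: "jaw (fish_shape j M) = j"
proof (cases "j = 0")
  case False
  then have "jaw (fish_shape j M) = length (takeWhile (\<lambda>x. x = East) (fish_shape j M))"
    using fish_shape_neq_empty_fish[of j M] by (simp add: jaw_def)
  also have "\<dots> = j"
    using False takeWhile_append2[of "replicate j East" "\<lambda>x. x = East"]
    by (simp add: fish_shape_def)
  finally show ?thesis .
qed (simp add: jaw_def fish_shape_def)

lemma aug_fish_shape: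
  assumes "1 \<le> i" "i \<le> j + 1"
  shows "aug_F i (fish_shape j M) = fish_shape i
    (if j = 0 then [West]
     else (if i \<le> j then replicate (j - i) East @ [North] else [Vee]) @ M @ [South])"
proof (cases "j = 0")
  case False
  then have "drop (Suc j) (fish_shape j M) = M @ [South]"
    by (simp add: fish_shape_def)
  then show ?thesis
    using False fish_shape_neq_empty_fish[of j M] jaw_fish_shape[of j M] assms
    by (auto simp: aug_F_def Let_def) (auto simp: fish_shape_def le_Suc_eq)
next
  case True
  then show ?thesis
    using assms by (simp add: aug_F_def fish_shape_def)
qed

lemma concat_fish_shape:
  assumes "0 < j1" "j2 = 0 \<Longrightarrow> M2 = []"
  shows "concat_F (fish_shape j1 M1) (fish_shape j2 M2) = fish_shape (j1 + j2) (M1 @ M2)"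
proof (cases "j2 = 0")
  case True
  then show ?thesis
    using assms fish_shape_neq_empty_fish[of j1 M1] by (simp add: concat_F_def) (simp add: fish_shape_def)
next
  case False
  then have "drop (Suc j2) (fish_shape j2 M2) = M2 @ [South]"
    "butlast (fish_shape j1 M1) = replicate j1 East @ [North] @ M1"
    using assms by (simp_all add: fish_shape_def butlast_append)
  then show ?thesis
    using False assms fish_shape_neq_empty_fish[of j1 M1] fish_shape_neq_empty_fish[of j2 M2]
      jaw_fish_shape[of j2 M2]
    by (simp add: concat_F_def) (simp add: fish_shape_def replicate_add add.commute[of j1])
qed

lemma child_counts_eq_Cons: "dyck P \<Longrightarrow> child_counts P = c0 P # tl (child_counts P)"
  using hd_child_counts[of P] hd_Cons_tl[of "child_counts P"] by simp

lemma down_runs_eq_Cons: "dyck Q \<Longrightarrow> down_runs Q = 0 # tl (down_runs Q)"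
  using hd_down_runs_dyck[of Q] hd_Cons_tl[of "down_runs Q"] by simp

lemma length_child_counts: "dyck P \<Longrightarrow> length (child_counts P) = Suc (count_list P Up)"
proof (induction P rule: dyck_induct)
  case (last_return A B)
  then show ?case
    using child_counts_last_return[of A B] by simp
qed (simp add: child_counts_Nil)

lemma count_Up_eq_0_iff: "dyck P \<Longrightarrow> count_list P Up = 0 \<longleftrightarrow> P = []"
  by (cases "P = []") (auto elim: dyck_last_return)

lemma compatible_Nil_iff:
  assumes "compatible (child_counts P) (down_runs Q)" "dyck P" "dyck Q"
  shows "P = [] \<longleftrightarrow> Q = []"
  using list_all2_lengthD[OF assms(1)[unfolded compatible_def]] assms(2,3)
    length_child_counts[of P] length_down_runs[of Q] count_Up_eq_0_iff[of P] count_Up_eq_0_iff[of Q] by simp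

abbreviation fish_body :: "step list \<Rightarrow> step list \<Rightarrow> letter list" where
  "fish_body P Q \<equiv> concat (map2 vertex_code (tl (child_counts P)) (tl (down_runs Q)))"

lemma fish_word_shape:
  assumes "compatible (child_counts P) (down_runs Q)" "dyck P" "dyck Q"
  shows "fish_word (child_counts P) (down_runs Q) = fish_shape (c0 P) (fish_body P Q)"
proof (cases "P = []")
  case True
  then have "Q = []"
    using assms compatible_Nil_iff by blast
  then show ?thesis
    using True by (simp add: child_counts_Nil fish_word_def fish_shape_def vertex_code_def empty_fish_def)
next
  case False
  then obtain j where j: "c0 P = Suc j"
    using assms(2) c0_eq_0_iff not0_implies_Suc by blast
  have "fish_word (c0 P # cs) (0 # ds) = fish_shape (c0 P) (concat (map2 vertex_code cs ds))" for cs ds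
    by (simp add: j fish_word_def fish_shape_def vertex_code_def)
  then show ?thesis
    using child_counts_eq_Cons[OF assms(2)] down_runs_eq_Cons[OF assms(3)] by metis
qed

text \<open>The final S that an augmentation adds is absorbed by the run of down steps that it
  lengthens.\<close>
lemma increment_last_run:
  assumes "length cs = length ds" "ds \<noteq> []" "last cs = 0" "0 < last ds"
  shows "concat (map2 vertex_code cs (butlast ds @ [Suc (last ds)])) =
      concat (map2 vertex_code cs ds) @ [South]"
    and "compatible cs ds \<Longrightarrow> compatible cs (butlast ds @ [Suc (last ds)])"
proof -
  obtain ds' d where ds: "ds = ds' @ [d]"
    using assms(2) by (cases ds rule: rev_cases) auto
  then obtain cs' where cs: "cs = cs' @ [0]" "length cs' = length ds'"
    using assms by (cases cs rule: rev_cases) auto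
  have "replicate d South = replicate (d - 1) South @ [South]"
    using assms(4) ds by (cases d) (simp_all add: replicate_append_same)
  then show "concat (map2 vertex_code cs (butlast ds @ [Suc (last ds)])) =
      concat (map2 vertex_code cs ds) @ [South]"
    using assms(4) cs ds by (simp add: vertex_code_def)
  show "compatible cs (butlast ds @ [Suc (last ds)])" if "compatible cs ds"
    using that cs ds by (simp add: compatible_def list_all2_append)
qed

text \<open>
  The closed formula satisfies the recursion of \<open>Phi\<close>. The list of P begins with the new jaw
  length, followed by the number \<open>c0 A\<close> of children of the new vertex. With \<open>j = c0 (A @ B)\<close> and
  \<open>i = c0 B + 1\<close> one has \<open>c0 A = j + 1 - i\<close>, so the block of the new vertex is exactly the factor
  \<open>E\<^bsup>j-i\<^esup>N\<close>, or V for \<open>i = j + 1\<close>, that the augmentation inserts. If the inner interval is empty,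
  the block of the new vertex is instead the W of ENWS.
\<close>
lemma fish_word_oplus:
  assumes 1: "compatible (child_counts (A @ B)) (down_runs Q1)" "dyck A" "dyck B" "dyck Q1"
    and 2: "compatible (child_counts P2) (down_runs Q2)" "dyck P2" "dyck Q2"
  defines "P \<equiv> Up # A @ [Down] @ B @ P2" and "Q \<equiv> Up # Q1 @ [Down] @ Q2"
  shows "compatible (child_counts P) (down_runs Q)"
    and "fish_word (child_counts P) (down_runs Q) =
      oplus_F (fish_word (child_counts (A @ B)) (down_runs Q1)) (c0 B + 1)
        (fish_word (child_counts P2) (down_runs Q2))"
proof -
  have dyck: "dyck (A @ B)" "dyck P" "dyck Q"
    using 1 2 dyck_append[of "Up # A @ [Down]" "B @ P2"] dyck_append[of "Up # Q1 @ [Down]" Q2]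
      dyck_append dyck_Up_Down by (auto simp: P_def Q_def)
  let ?D = "butlast (down_runs Q1) @ [Suc (last (down_runs Q1))]"
  let ?cs = "tl (child_counts (A @ B))"
  let ?ds = "tl (down_runs Q1)"
  let ?j = "c0 (A @ B)"
  let ?i = "c0 B + 1"
  have ar: "child_counts P = (?i + c0 P2) # c0 A # ?cs @ tl (child_counts P2)"
    using child_counts_first_return[of A B P2] 1 2 by (simp add: P_def)
  have dr: "down_runs Q = 0 # ?D @ tl (down_runs Q2)"
    using down_runs_first_return[of Q2 Q1] 2 by (simp add: Q_def)
  have j: "?j = c0 A + c0 B"
    using 1 by (simp add: c0_append)
  have c0P: "c0 P = ?i + c0 P2"
    using hd_child_counts[OF dyck(2)] ar by simp
  have len1: "length ?cs = length ?ds"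
    using 1(1) by (simp add: compatible_def list_all2_lengthD)
  have comp2: "compatible (tl (child_counts P2)) (tl (down_runs Q2))"
    using 2(1) child_counts_eq_Cons[OF 2(2)] down_runs_eq_Cons[OF 2(3)]
    by (metis compatible_def list_all2_Cons)
  have comp1: "compatible ?cs ?ds"
    using 1(1) child_counts_eq_Cons[OF dyck(1)] down_runs_eq_Cons[OF 1(4)]
    by (metis compatible_def list_all2_Cons)
  \<comment> \<open>the first vertex below the new root, together with the fish of the inner interval\<close>
  have inner: "compatible (c0 A # ?cs) ?D \<and>
    concat (map2 vertex_code (c0 A # ?cs) ?D) =
      (if ?j = 0 then [West]
       else (if ?i \<le> ?j then replicate (?j - ?i) East @ [North] else [Vee])
         @ fish_body (A @ B) Q1 @ [South])"
  proof (cases "Q1 = []")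
    case True
    then have "A @ B = []"
      using compatible_Nil_iff[OF 1(1) dyck(1) 1(4)] by simp
    then show ?thesis
      using True by (simp add: child_counts_Nil compatible_def vertex_code_def)
  next
    case False
    then have "A @ B \<noteq> []"
      using compatible_Nil_iff[OF 1(1) dyck(1) 1(4)] by blast
    then have "?j \<noteq> 0"
      using dyck(1) c0_eq_0_iff by blast
    have "?ds \<noteq> []"
      using False length_down_runs[of Q1] count_Up_eq_0_iff[OF 1(4)]
      by (metis length_0_conv length_tl diff_Suc_1)
    moreover from this have "?cs \<noteq> []"
      using len1 by (metis length_0_conv)
    ultimately have last: "last ?ds = last (down_runs Q1)" "last ?cs = 0"
      using last_child_counts[OF dyck(1)] by (simp_all add: last_tl)
    have D: "?D = 0 # butlast ?ds @ [Suc (last ?ds)]"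
      using down_runs_eq_Cons[OF 1(4)] \<open>?ds \<noteq> []\<close> last(1) by (metis append_Cons butlast.simps(2))
    have "0 < last ?ds"
      using last_down_runs_dyck[OF 1(4) False] last(1) by simp
    then have "concat (map2 vertex_code ?cs (butlast ?ds @ [Suc (last ?ds)])) =
        fish_body (A @ B) Q1 @ [South]"
      "compatible ?cs (butlast ?ds @ [Suc (last ?ds)])"
      using increment_last_run[OF len1 \<open>?ds \<noteq> []\<close> last(2)] comp1 by auto
    moreover have "vertex_code (c0 A) 0 =
        (if ?i \<le> ?j then replicate (?j - ?i) East @ [North] else [Vee])"
      using j by (auto simp: vertex_code_def)
    ultimately show ?thesis
      using \<open>?j \<noteq> 0\<close> unfolding D by (simp add: compatible_def)
  qed
  note inner_compatible = conjunct1[OF inner] and inner_word = conjunct2[OF inner]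
  have len: "length (c0 A # ?cs) = length ?D"
    using inner_compatible unfolding compatible_def by (rule list_all2_lengthD)
  have "list_all2 (\<lambda>c d. c = 0 \<or> d = 0) ((c0 A # ?cs) @ tl (child_counts P2)) (?D @ tl (down_runs Q2))"
    using inner_compatible comp2 unfolding compatible_def by (rule list_all2_appendI)
  then show comp: "compatible (child_counts P) (down_runs Q)"
    unfolding ar dr compatible_def by (simp only: append_Cons list_all2_Cons) simp
  have tls: "tl (child_counts P) = (c0 A # ?cs) @ tl (child_counts P2)" "tl (down_runs Q) = ?D @ tl (down_runs Q2)"
    unfolding ar dr by simp_all
  have body: "fish_body P Q = concat (map2 vertex_code (c0 A # ?cs) ?D) @ fish_body P2 Q2"
    unfolding tls zip_append[OF len] map_append concat_append ..
  have body2: "fish_body P2 Q2 = []" if "c0 P2 = 0"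
    using that 2(2) c0_eq_0_iff[of P2] by (simp add: child_counts_Nil)
  have i: "1 \<le> ?i" "?i \<le> ?j + 1"
    using j by simp_all
  have "oplus_F (fish_word (child_counts (A @ B)) (down_runs Q1)) ?i
        (fish_word (child_counts P2) (down_runs Q2)) =
      concat_F (fish_shape ?i (concat (map2 vertex_code (c0 A # ?cs) ?D)))
        (fish_shape (c0 P2) (fish_body P2 Q2))"
    unfolding oplus_F_def fish_word_shape[OF 1(1) dyck(1) 1(4)] fish_word_shape[OF 2]
      aug_fish_shape[OF i] inner_word ..
  also have "\<dots> = fish_shape (c0 P) (fish_body P Q)"
    unfolding body c0P using body2 by (intro concat_fish_shape) simp_all
  also have "\<dots> = fish_word (child_counts P) (down_runs Q)"
    using fish_word_shape[OF comp dyck(2,3)] by simp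
  finally show "fish_word (child_counts P) (down_runs Q) =
      oplus_F (fish_word (child_counts (A @ B)) (down_runs Q1)) ?i
        (fish_word (child_counts P2) (down_runs Q2))" ..
qed

section \<open>The map from intervals to fish in closed form\<close>

text \<open>This also shows that the recursion is functional: the right-hand side depends on the interval
  only.\<close>
lemma Phi_rel_imp_fish_word:
  assumes "Phi_rel I F" "tamari_interval I"
  shows "compatible (child_counts (fst I)) (down_runs (snd I)) \<and>
    F = fish_word (child_counts (fst I)) (down_runs (snd I))"
  using assms(1)
proof induction
  case 1
  show ?case
    by (simp add: child_counts_Nil compatible_def fish_word_def vertex_code_def empty_fish_def)
next
  case (2 I1 i I2 F1 F2)
  obtain P1 Q1 P2 Q2 where I: "I1 = (P1, Q1)" "I2 = (P2, Q2)"
    by (cases I1; cases I2) auto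
  have dyck: "dyck P1" "dyck Q1" "dyck P2" "dyck Q2"
    using 2 by (auto simp: I tamari_interval_def tamari_le_def)
  obtain A B where AB: "P1 = A @ B" "dyck A" "dyck B" "i = c0 B + 1"
    "contact_from_right i P1 = length A"
    using contact_split[OF dyck(1)] 2(2,3) unfolding I by (metis fst_conv)
  have "oplus_I I1 i I2 = (Up # A @ [Down] @ B @ P2, Up # Q1 @ [Down] @ Q2)"
    using AB(5) unfolding I AB(1) by (simp add: oplus_I_def aug_I_def concat_I_def Let_def)
  then show ?case
    using fish_word_oplus[of A B Q1 P2 Q2] 2 AB dyck by (simp add: I)
qed

lemma Phi_rel_total:
  assumes "tamari_interval (P, Q)"
  shows "\<exists>F. Phi_rel (P, Q) F"
  using assms
proof (induction "length Q" arbitrary: P Q rule: less_induct)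
  case less
  have le: "tamari_le P Q" "dyck Q" "length P = length Q"
    using less.prems by (auto simp: tamari_interval_def tamari_le_def)
  show ?case
  proof (cases "Q = []")
    case True
    then show ?thesis
      using le Phi_rel.intros(1) by auto
  next
    case False
    then obtain Q1 Q2 where Q: "Q = Up # Q1 @ [Down] @ Q2" "dyck Q1" "dyck Q2"
      using dyck_first_return[OF le(2)] by auto
    then obtain A B P2 where P: "P = Up # A @ [Down] @ B @ P2" "dyck A" "dyck B"
      "tamari_le (A @ B) Q1" "tamari_le P2 Q2"
      using tamari_le_first_return[of P Q1 Q2] le by blast
    obtain F1 F2 where "Phi_rel (A @ B, Q1) F1" "Phi_rel (P2, Q2) F2"
      using less.hyps[of Q1 "A @ B"] less.hyps[of Q2 P2] P Q by (auto simp: tamari_interval_def)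
    then have "Phi_rel (oplus_I (A @ B, Q1) (c0 B + 1) (P2, Q2)) (oplus_F F1 (c0 B + 1) F2)"
      using P c0_append[of A B] by (intro Phi_rel.intros) (simp_all add: tamari_interval_def)
    moreover have "oplus_I (A @ B, Q1) (c0 B + 1) (P2, Q2) = (P, Q)"
      using contact_from_right_append[OF P(2,3)] P(1) Q(1)
      by (simp add: oplus_I_def aug_I_def concat_I_def Let_def)
    ultimately show ?thesis by auto
  qed
qed

lemma Phi_eq_fish_word:
  assumes "tamari_interval (P, Q)"
  shows "Phi (P, Q) = fish_word (child_counts P) (down_runs Q)"
    and "compatible (child_counts P) (down_runs Q)"
proof -
  obtain F where F: "Phi_rel (P, Q) F"
    using Phi_rel_total[OF assms] by blast
  moreover have "G = fish_word (child_counts P) (down_runs Q)" if "Phi_rel (P, Q) G" for G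
    using Phi_rel_imp_fish_word[OF that assms] by simp
  ultimately show "Phi (P, Q) = fish_word (child_counts P) (down_runs Q)"
    unfolding Phi_def by (metis the_equality)
  show "compatible (child_counts P) (down_runs Q)"
    using Phi_rel_imp_fish_word[OF F assms] by simp
qed

section \<open>Letter statistics\<close>

lemma factor_count_short [simp]: "factor_count [a, b] [] = 0" "factor_count [a, b] [x] = 0"
  by (simp_all add: factor_count_def)

lemma factor_count_Cons [simp]:
  "factor_count [a, b] (x # y # xs) = of_bool (x = a \<and> y = b) + factor_count [a, b] (y # xs)"
proof -
  let ?S = "\<lambda>P. {k. k + length [a, b] \<le> length P \<and> take (length [a, b]) (drop k P) = [a, b]}"
  have "finite (?S (y # xs))"
    by (rule finite_subset[of _ "{..length (y # xs)}"]) auto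
  moreover have "?S (x # y # xs) = (if x = a \<and> y = b then {0} else {}) \<union> Suc ` ?S (y # xs)"
  proof (rule set_eqI)
    fix k
    show "k \<in> ?S (x # y # xs) \<longleftrightarrow>
        k \<in> (if x = a \<and> y = b then {0} else {}) \<union> Suc ` ?S (y # xs)"
      by (cases k) auto
  qed
  moreover have "card ((if c then {0} else {}) \<union> Suc ` S) = of_bool c + card S" if "finite S" for c S
    using that by (cases c) (auto simp: card_image card_insert_if)
  ultimately show ?thesis
    unfolding factor_count_def by presburger
qed

lemma factor_count_append:
  "factor_count [a, b] (xs @ ys) = factor_count [a, b] xs + factor_count [a, b] ys +
    of_bool (xs \<noteq> [] \<and> ys \<noteq> [] \<and> last xs = a \<and> hd ys = b)"
proof (induction xs)
  case (Cons x xs)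
  then show ?case
    by (cases xs; cases ys) auto
qed simp

lemma dyck_ends:
  assumes "dyck P" "P \<noteq> []"
  shows "hd P = Up" "last P = Down"
proof -
  show "hd P = Up"
    using assms by (rule dyck_first_return) simp
  show "last P = Down"
    using assms by (rule dyck_last_return) simp
qed

lemma Val_last_return:
  assumes "dyck A" "dyck B"
  shows "Val (A @ [Up] @ B @ [Down]) = Val A + of_bool (A \<noteq> []) + Val B"
proof -
  have "Val (Up # B @ [Down]) = Val B"
    using factor_count_append[of Down Up "[Up]" "B @ [Down]"]
      factor_count_append[of Down Up B "[Down]"] by (simp add: Val_def)
  then show ?thesis
    using factor_count_append[of Down Up A "Up # B @ [Down]"] dyck_ends[of A] assms
    by (auto simp: Val_def)
qed

lemma DR_last_return:
  assumes "dyck A" "dyck B"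
  shows "DR (A @ [Up] @ B @ [Down]) = DR A + DR B + of_bool (B \<noteq> [])"
proof -
  have "DR (Up # B @ [Down]) = DR B + of_bool (B \<noteq> [])"
    using factor_count_append[of Up Up "[Up]" "B @ [Down]"] dyck_ends[of B] assms
      factor_count_append[of Up Up B "[Down]"] by (cases "B = []") (simp_all add: DR_def)
  then show ?thesis
    using factor_count_append[of Up Up A "Up # B @ [Down]"] dyck_ends[of A] assms
    by (auto simp: DR_def)
qed

lemma Val_DR_conj_D:
  assumes "dyck P"
  shows "Val (conj_D P) = DR P" "DR (conj_D P) = Val P"
proof -
  have "Val (conj_D P) = DR P \<and> DR (conj_D P) = Val P"
    using assms
  proof (induction P rule: dyck_induct)
    case Nil
    then show ?case by (simp add: conj_D_Nil Val_def DR_def)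
  next
    case (last_return A B)
    have "conj_D A = [] \<longleftrightarrow> A = []" "conj_D B = [] \<longleftrightarrow> B = []"
      using last_return.hyps length_conj_D by (metis length_0_conv)+
    then show ?case
      using last_return Val_last_return[of A B] DR_last_return[of A B] conj_D_append[of A B]
        Val_last_return[of "conj_D B" "conj_D A"] DR_last_return[of "conj_D B" "conj_D A"]
        dyck_conj_D by simp
  qed
  then show "Val (conj_D P) = DR P" "DR (conj_D P) = Val P" by auto
qed

text \<open>A vertex with c > 0 children contributes the c - 1 valleys between the arches of its children.\<close>
lemma sum_child_counts_Val:
  assumes "dyck P"
  shows "(\<Sum>c\<leftarrow>child_counts P. c - 1) = Val P"
  using assms
proof (induction P rule: dyck_induct)
  case Nil
  then show ?case by (simp add: child_counts_Nil Val_def)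
next
  case (last_return A B)
  have "(\<Sum>c\<leftarrow>child_counts A. c - 1) = (c0 A - 1) + (\<Sum>c\<leftarrow>tl (child_counts A). c - 1)"
    using child_counts_eq_Cons[OF last_return(1)] by (metis list.simps(9) sum_list.Cons)
  moreover have "c0 A = c0 A - 1 + of_bool (A \<noteq> [])"
    using c0_eq_0_iff[OF last_return(1)] by (cases "A = []") auto
  ultimately show ?case
    using last_return child_counts_last_return[of A B] hd_child_counts[of A] Val_last_return[of A B] by simp
qed

text \<open>A double rise is the up step of a vertex followed by that of its first child. The virtual root
  has no up step, whence the additional term.\<close>
lemma sum_child_counts_DR:
  assumes "dyck P"
  shows "(\<Sum>c\<leftarrow>child_counts P. of_bool (0 < c)) = DR P + of_bool (P \<noteq> [])"
  using assms
proof (induction P rule: dyck_induct)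
  case Nil
  then show ?case by (simp add: child_counts_Nil DR_def)
next
  case (last_return A B)
  have "(\<Sum>c\<leftarrow>child_counts A. of_bool (0 < c)) =
      of_bool (0 < c0 A) + (\<Sum>c\<leftarrow>tl (child_counts A). of_bool (0 < c) :: nat)"
    using child_counts_eq_Cons[OF last_return(1)] by (metis list.simps(9) sum_list.Cons)
  then have "(\<Sum>c\<leftarrow>tl (child_counts A). of_bool (0 < c)) = DR A"
    using last_return c0_eq_0_iff[of A] by (cases "A = []") simp_all
  then show ?case
    using last_return child_counts_last_return[of A B] DR_last_return[of A B] by simp
qed

lemma count_fish_word:
  assumes "length cs = length ds"
  shows "count_list (fish_word cs ds) East = (\<Sum>c\<leftarrow>cs. c - 1) + 1"
    and "count_list (fish_word cs ds) North = (\<Sum>c\<leftarrow>cs. of_bool (0 < c))"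
proof -
  have rep: "count_list (replicate n x) y = (if x = y then n else 0)" for n and x y :: letter
    by (induction n) auto
  have "count_list (concat (map2 vertex_code cs ds)) East = (\<Sum>c\<leftarrow>cs. c - 1) \<and>
    count_list (concat (map2 vertex_code cs ds)) North = (\<Sum>c\<leftarrow>cs. of_bool (0 < c))"
    using assms by (induction cs ds rule: list_induct2) (auto simp: vertex_code_def rep)
  then show "count_list (fish_word cs ds) East = (\<Sum>c\<leftarrow>cs. c - 1) + 1"
    "count_list (fish_word cs ds) North = (\<Sum>c\<leftarrow>cs. of_bool (0 < c))"
    by (simp_all add: fish_word_def)
qed

lemma count_conj_F: "count_list (conj_F F) (conj_letter x) = count_list F x"
proof -
  have "inj conj_letter"
  proof (rule injI)
    fix y z assume "conj_letter y = conj_letter z"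
    then show "y = z" by (cases y; cases z) simp_all
  qed
  then have "count_list (map conj_letter F) (conj_letter x) = count_list F x"
    by (induction F) (auto simp: inj_eq)
  then show ?thesis
    by (simp add: conj_F_def rev_map[symmetric])
qed

lemma count_Phi_East_North:
  assumes "tamari_interval (P, Q)"
  shows "count_list (Phi (P, Q)) East = Val P + 1"
    and "P \<noteq> [] \<Longrightarrow> count_list (Phi (P, Q)) North = DR P + 1"
proof -
  have len: "length (child_counts P) = length (down_runs Q)"
    using Phi_eq_fish_word(2)[OF assms] unfolding compatible_def by (rule list_all2_lengthD)
  have P: "dyck P"
    using assms by (simp add: tamari_interval_def tamari_le_def)
  show "count_list (Phi (P, Q)) East = Val P + 1"
    unfolding Phi_eq_fish_word(1)[OF assms] count_fish_word(1)[OF len] sum_child_counts_Val[OF P] ..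
  show "count_list (Phi (P, Q)) North = DR P + 1" if "P \<noteq> []"
    unfolding Phi_eq_fish_word(1)[OF assms] count_fish_word(2)[OF len] sum_child_counts_DR[OF P]
    using that by simp
qed

theorem proposition12:
  fixes P Q :: "step list"
  assumes "tamari_interval (P, Q)"
  shows "conj_F (Phi (P, Q)) = Phi (conj_I (P, Q))
    \<and> count_list (Phi (P, Q)) East = Val P + 1
    \<and> (P \<noteq> [] \<longrightarrow> count_list (Phi (P, Q)) North = DR P + 1)
    \<and> (P \<noteq> [] \<longrightarrow> count_list (Phi (P, Q)) West = Val Q + 1)
    \<and> count_list (Phi (P, Q)) South = DR Q + 1"
proof -
  have le: "tamari_le P Q" "dyck P" "dyck Q" "length P = length Q"
    using assms by (auto simp: tamari_interval_def tamari_le_def)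
  have conj: "tamari_interval (conj_D Q, conj_D P)"
    using tamari_le_conj_D[OF le(1)] by (simp add: tamari_interval_def)
  have "rev (down_runs Q) = child_counts (conj_D Q)" "rev (child_counts P) = down_runs (conj_D P)"
    using le(2,3) by (simp_all add: child_counts_conj_D) (simp add: child_counts_def)
  then have Phi_conj: "conj_F (Phi (P, Q)) = Phi (conj_I (P, Q))"
    using conj_fish_word[of "child_counts P" "down_runs Q"] Phi_eq_fish_word[OF assms]
      Phi_eq_fish_word[OF conj] by (simp add: conj_I_def)
  moreover have "count_list (Phi (P, Q)) South = DR Q + 1"
    using count_conj_F[of "Phi (P, Q)" South] count_Phi_East_North(1)[OF conj] Phi_conj
      Val_DR_conj_D[OF le(3)] by (simp add: conj_I_def)
  moreover have "count_list (Phi (P, Q)) West = Val Q + 1" if "P \<noteq> []"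
  proof -
    have "conj_D Q \<noteq> []"
      using that length_conj_D[OF le(3)] le(4) by auto
    then show ?thesis
      using count_conj_F[of "Phi (P, Q)" West] count_Phi_East_North(2)[OF conj] Phi_conj
        Val_DR_conj_D[OF le(3)] by (simp add: conj_I_def)
  qed
  ultimately show ?thesis
    using count_Phi_East_North[OF assms] by blast
qed

end
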